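(* Let $d\ge1$, let $S \in \mathrm{Sp}(2d,\mathbb R)$ and let $U$ be any unitary operator on $L^2(\mathbb R^d)$ that is $\rho$-related to $S$. Then, for every lattice $\Lambda \subset \mathbb R^{2d}$ and all $g,h\in L^2(\mathbb R^d)$, the following holds. (i) $\mathcal G(g, \Lambda)$ is a Bessel sequence if and only if $\mathcal G(Ug, S\Lambda)$ is a Bessel sequence. (ii) $\mathcal G(g, \Lambda)$ is a Gabor frame if and only if $\mathcal G(Ug, S\Lambda)$ is a Gabor frame. (iii) If $\mathcal G(g, \Lambda)$ and $\mathcal G(h, \Lambda)$ are Bessel sequences, then $S^{S\Lambda}_{Ug, Uh} = U\, S^\Lambda_{g, h}\, U^*$. Moreover, in the case of (i) (respectively (ii)) the optimal Bessel bounds (respectively the optimal frame bounds) of $\mathcal G(g,\Lambda)$ and $\mathcal G(Ug,S\Lambda)$ are equal, and duality is respected: $(S\Lambda)^\circ = S\Lambda^\circ$.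
   Context: $J = \begin{pmatrix} 0 & I \\ -I & 0\end{pmatrix}$ is the standard $2d\times 2d$ symplectic matrix; $\mathrm{Sp}(2d,\mathbb R)=\{S : S^TJS=J\}$. For $x,\omega\in\mathbb R^d$, $T_xf(t)=f(t-x)$ and $M_\omega f(t)=e^{2\pi i t\cdot\omega}f(t)$ on $L^2(\mathbb R^d)$; for $z=(x,\omega)\in\mathbb R^{2d}$, $\pi(z)=M_\omega T_x$ and $\rho(z)=e^{-\pi i x\cdot\omega}\pi(z)$. A unitary operator $U$ on $L^2(\mathbb R^d)$ is $\rho$-related to $S\in\mathrm{Sp}(2d,\mathbb R)$ if $U\rho(z)U^*=\rho(Sz)$ for all $z\in\mathbb R^{2d}$. A lattice in $\mathbb R^{2d}$ is a set $\Lambda=A\mathbb Z^{2d}$ with $A\in\mathrm{GL}(2d,\mathbb R)$. For $g\in L^2(\mathbb R^d)$ the Gabor system is $\mathcal G(g,\Lambda)=\{\pi(z)g : z\in\Lambda\}$ (indexed by $\Lambda$). It is a Bessel sequence if there is $C_2>0$ with $\sum_{z\in\Lambda}|\langle f,\pi(z)g\rangle|^2\le C_2\|f\|^2$ for all $f\in L^2(\mathbb R^d)$, and a (Gabor) frame if in addition there is $C_1>0$ with $C_1\|f\|^2\le\sum_{z\in\Lambda}|\langle f,\pi(z)g\rangle|^2$ for all $f$. The optimal Bessel bound is the smallest possible $C_2$; the optimal frame bounds are the largest possible $C_1$ and the smallest possible $C_2$. If $\mathcal G(g,\Lambda)$ and $\mathcal G(h,\Lambda)$ are Bessel sequences, the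 (mixed-type) frame operator is the bounded operator $S^\Lambda_{g,h}f=\sum_{z\in\Lambda}\langle f,\pi(z)g\rangle\pi(z)h$ on $L^2(\mathbb R^d)$. Inner products are linear in the first argument. The adjoint lattice of $\Lambda$ is $\Lambda^\circ=\{z\in\mathbb R^{2d} : \pi(z)\pi(\lambda)=\pi(\lambda)\pi(z)\text{ for all }\lambda\in\Lambda\}$; equivalently $\Lambda^\circ=-JA^{-T}\mathbb Z^{2d}$ if $\Lambda=A\mathbb Z^{2d}$. *)

theory Defs
  imports "HOL-Analysis.Analysis"
begin

section \<open>The Hilbert space of square-integrable functions\<close>

definition square_integrable :: "('a::euclidean_space \<Rightarrow> complex) \<Rightarrow> bool" where
  "square_integrable f \<longleftrightarrow>
     f \<in> borel_measurable lborel \<and> integrable lborel (\<lambda>t. (cmod (f t))\<^sup>2)"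

lemma square_integrable_zero: "square_integrable (\<lambda>_. 0)"
  by (simp add: square_integrable_def)

lemma square_integrable_scale:
  assumes "square_integrable f"
  shows "square_integrable (\<lambda>t. c * f t)"
  using assms by (auto simp: square_integrable_def norm_mult power_mult_distrib)

lemma square_integrable_add:
  assumes "square_integrable f" "square_integrable g"
  shows "square_integrable (\<lambda>t. f t + g t)"
proof -
  have m: "f \<in> borel_measurable lborel" "g \<in> borel_measurable lborel"
    using assms by (auto simp: square_integrable_def)
  have "integrable lborel (\<lambda>t. (cmod (f t + g t))\<^sup>2)"
  proof (rule Bochner_Integration.integrable_bound)
    show "integrable lborel (\<lambda>t. 2 * (cmod (f t))\<^sup>2 + 2 * (cmod (g t))\<^sup>2)"
      using assms by (auto simp: square_integrable_def)
    show "(\<lambda>t. (cmod (f t + g t))\<^sup>2) \<in> borel_measurable lborel"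
      using m by measurable
    show "AE t in lborel. norm ((cmod (f t + g t))\<^sup>2)
            \<le> norm (2 * (cmod (f t))\<^sup>2 + 2 * (cmod (g t))\<^sup>2)"
    proof (rule AE_I2)
      fix t
      have "(cmod (f t + g t))\<^sup>2 \<le> (cmod (f t) + cmod (g t))\<^sup>2"
        by (intro power_mono norm_triangle_ineq) auto
      also have "\<dots> \<le> 2 * (cmod (f t))\<^sup>2 + 2 * (cmod (g t))\<^sup>2"
        using zero_le_power2[of "cmod (f t) - cmod (g t)"]
        by (simp add: power2_eq_square algebra_simps)
      finally show "norm ((cmod (f t + g t))\<^sup>2)
            \<le> norm (2 * (cmod (f t))\<^sup>2 + 2 * (cmod (g t))\<^sup>2)"
        by simp
    qed
  qed
  with m show ?thesis by (auto simp: square_integrable_def)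
qed

lemma integrable_mult_cnj:
  assumes "square_integrable f" "square_integrable g"
  shows "integrable lborel (\<lambda>t. f t * cnj (g t))"
proof -
  have m: "f \<in> borel_measurable lborel" "g \<in> borel_measurable lborel"
    using assms by (auto simp: square_integrable_def)
  show ?thesis
  proof (rule Bochner_Integration.integrable_bound)
    show "integrable lborel (\<lambda>t. (cmod (f t))\<^sup>2 + (cmod (g t))\<^sup>2)"
      using assms by (auto simp: square_integrable_def)
    have "(\<lambda>t. cnj (g t)) \<in> borel_measurable lborel"
      using m(2) by (intro borel_measurable_continuous_on[where f = cnj]) (auto intro: continuous_intros)
    with m(1) show "(\<lambda>t. f t * cnj (g t)) \<in> borel_measurable lborel"
      by (rule borel_measurable_times)
    show "AE t in lborel. norm (f t * cnj (g t)) \<le> norm ((cmod (f t))\<^sup>2 + (cmod (g t))\<^sup>2)"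
    proof (rule AE_I2)
      fix t
      have "2 * (cmod (f t) * cmod (g t)) \<le> (cmod (f t))\<^sup>2 + (cmod (g t))\<^sup>2"
        using zero_le_power2[of "cmod (f t) - cmod (g t)"]
        by (simp add: power2_eq_square algebra_simps)
      moreover have "0 \<le> cmod (f t) * cmod (g t)" by simp
      ultimately have "cmod (f t) * cmod (g t) \<le> (cmod (f t))\<^sup>2 + (cmod (g t))\<^sup>2"
        by linarith
      then show "norm (f t * cnj (g t)) \<le> norm ((cmod (f t))\<^sup>2 + (cmod (g t))\<^sup>2)"
        by (simp add: norm_mult)
    qed
  qed
qed

lemma AE_lborel_shift:
  fixes x :: "'a::euclidean_space"
  assumes "AE t in lborel. P t"
  shows "AE t in lborel. P (t - x)"
proof -
  have "AE t in distr lborel borel ((+) (- x)). P t"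
    using assms by (simp only: lborel_distr_plus)
  then have "AE t in lborel. P (- x + t)"
    by (rule AE_distrD[rotated]) auto
  then show ?thesis by simp
qed

lemma square_integrable_shift:
  fixes x :: "'a::euclidean_space"
  assumes "square_integrable f"
  shows "square_integrable (\<lambda>t. f (t - x))"
proof -
  have m: "f \<in> borel_measurable borel"
    using assms by (simp add: square_integrable_def)
  have "integrable (distr lborel borel ((+) (- x))) (\<lambda>t. (cmod (f t))\<^sup>2)"
    using assms by (simp only: lborel_distr_plus square_integrable_def)
  then have "integrable lborel (\<lambda>t. (cmod (f (- x + t)))\<^sup>2)"
    using m by (subst (asm) integrable_distr_eq) auto
  moreover have "(\<lambda>t. f (t - x)) \<in> borel_measurable borel"
    using m by measurable
  ultimately show ?thesis by (simp add: square_integrable_def)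
qed

lemma square_integrable_modulate:
  fixes w :: "'a::euclidean_space"
  assumes "square_integrable f"
  shows "square_integrable (\<lambda>t. exp (2 * of_real pi * \<i> * of_real (t \<bullet> w)) * f t)"
proof -
  have "(\<lambda>t. exp (2 * of_real pi * \<i> * complex_of_real (t \<bullet> w))) \<in> borel_measurable borel"
    by (intro borel_measurable_continuous_onI continuous_intros)
  with assms show ?thesis
    by (auto simp: square_integrable_def norm_mult)
qed

text \<open>Elements of \<open>'a L2\<close> are classes of Borel measurable square-integrable functions modulo
  equality almost everywhere (every Lebesgue measurable function agrees a.e. with a Borel one), so that \<open>(real ^ 'd) L2\<close> is $L^2(\mathbb R^d)$.\<close>

quotient_type (overloaded) 'a L2 = "'a::euclidean_space \<Rightarrow> complex" / partial:
  "\<lambda>f g. square_integrable f \<and> square_integrable g \<and> (AE t in lborel. f t = g t)"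
proof (rule part_equivpI)
  show "\<exists>f::'a \<Rightarrow> complex. square_integrable f \<and> square_integrable f \<and> (AE t in lborel. f t = f t)"
    using square_integrable_zero by auto
  show "symp (\<lambda>f g :: 'a \<Rightarrow> complex.
          square_integrable f \<and> square_integrable g \<and> (AE t in lborel. f t = g t))"
    by (rule sympI) (auto elim: eventually_mono)
  show "transp (\<lambda>f g :: 'a \<Rightarrow> complex.
          square_integrable f \<and> square_integrable g \<and> (AE t in lborel. f t = g t))"
    by (rule transpI) (auto elim: eventually_elim2)
qed

lift_definition scaleC_L2 :: "complex \<Rightarrow> 'a::euclidean_space L2 \<Rightarrow> 'a L2" (infixr "*\<^sub>C" 75)
  is "\<lambda>c f t. c * f t"
  by (auto intro: square_integrable_scale elim: eventually_mono)

lift_definition cinner :: "'a::euclidean_space L2 \<Rightarrow> 'a L2 \<Rightarrow> complex"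
  is "\<lambda>f g. \<integral>t. f t * cnj (g t) \<partial>lborel"
proof -
  fix f f' g g' :: "'a \<Rightarrow> complex"
  assume f: "square_integrable f \<and> square_integrable f' \<and> (AE t in lborel. f t = f' t)"
    and g: "square_integrable g \<and> square_integrable g' \<and> (AE t in lborel. g t = g' t)"
  have "AE t in lborel. f t * cnj (g t) = f' t * cnj (g' t)"
    using f g by (auto elim: eventually_elim2)
  then show "(\<integral>t. f t * cnj (g t) \<partial>lborel) = (\<integral>t. f' t * cnj (g' t) \<partial>lborel)"
    using f g by (intro integral_cong_AE)
      (blast intro: borel_measurable_integrable integrable_mult_cnj)+
qed

text \<open>The library has no complex inner product spaces. The real structure with inner product
  \<open>Re (cinner f g)\<close> yields the usual $L^2$-norm and hence the norm topology.\<close>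

instantiation L2 :: (euclidean_space) real_inner
begin

lift_definition zero_L2 :: "'a L2" is "\<lambda>_. 0"
  by (simp add: square_integrable_zero)

lift_definition plus_L2 :: "'a L2 \<Rightarrow> 'a L2 \<Rightarrow> 'a L2" is "\<lambda>f g t. f t + g t"
  by (auto intro: square_integrable_add elim: eventually_elim2)

lift_definition uminus_L2 :: "'a L2 \<Rightarrow> 'a L2" is "\<lambda>f t. - f t"
  by (auto simp: square_integrable_def elim: eventually_mono)

definition minus_L2 :: "'a L2 \<Rightarrow> 'a L2 \<Rightarrow> 'a L2" where
  "minus_L2 f g = f + - g"

definition scaleR_L2 :: "real \<Rightarrow> 'a L2 \<Rightarrow> 'a L2" where
  "scaleR_L2 r f = complex_of_real r *\<^sub>C f"

definition inner_L2 :: "'a L2 \<Rightarrow> 'a L2 \<Rightarrow> real" where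
  "inner_L2 f g = Re (cinner f g)"

definition norm_L2 :: "'a L2 \<Rightarrow> real" where
  "norm_L2 f = sqrt (inner f f)"

definition dist_L2 :: "'a L2 \<Rightarrow> 'a L2 \<Rightarrow> real" where
  "dist_L2 f g = norm (f - g)"

definition sgn_L2 :: "'a L2 \<Rightarrow> 'a L2" where
  "sgn_L2 f = scaleR (inverse (norm f)) f"

definition uniformity_L2 :: "('a L2 \<times> 'a L2) filter" where
  "uniformity_L2 = (INF e\<in>{0 <..}. principal {(f, g). dist f g < e})"

definition open_L2 :: "'a L2 set \<Rightarrow> bool" where
  "open_L2 X = (\<forall>f\<in>X. eventually (\<lambda>(f', g). f' = f \<longrightarrow> g \<in> X) uniformity)"

instance
proof
  fix f g h :: "'a L2" and r s :: real
  show "f + g + h = f + (g + h)"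
    by transfer (auto intro!: square_integrable_add simp: add.assoc)
  show "f + g = g + f"
    by transfer (auto intro!: square_integrable_add simp: add.commute)
  show "0 + f = f" by transfer auto
  show "- f + f = 0" by transfer (auto simp: square_integrable_zero)
  show "f - g = f + - g" by (simp add: minus_L2_def)
  show "r *\<^sub>R (f + g) = r *\<^sub>R f + r *\<^sub>R g"
    unfolding scaleR_L2_def
    by transfer (auto intro!: square_integrable_add square_integrable_scale simp: distrib_left)
  show "(r + s) *\<^sub>R f = r *\<^sub>R f + s *\<^sub>R f"
    unfolding scaleR_L2_def
    by transfer (auto intro!: square_integrable_add square_integrable_scale
        square_integrable_scale[of _ "complex_of_real r + complex_of_real s"] simp: distrib_right)
  show "r *\<^sub>R s *\<^sub>R f = (r * s) *\<^sub>R f"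
    unfolding scaleR_L2_def
    by transfer (auto intro!: square_integrable_scale
        square_integrable_scale[of _ "complex_of_real r * complex_of_real s", simplified] simp: mult.assoc)
  show "1 *\<^sub>R f = f" unfolding scaleR_L2_def by transfer auto
  show "dist f g = norm (f - g)" by (simp add: dist_L2_def)
  show "sgn f = scaleR (inverse (norm f)) f" by (simp add: sgn_L2_def)
  show "uniformity = (INF e\<in>{0 <..}. principal {(f :: 'a L2, g). dist f g < e})"
    by (simp add: uniformity_L2_def)
  show "open X = (\<forall>f\<in>X. eventually (\<lambda>(f', g). f' = f \<longrightarrow> g \<in> X) uniformity)"
    for X :: "'a L2 set" by (simp add: open_L2_def)
  show "inner f g = inner g f"
  proof -
    have "cinner f g = cnj (cinner g f)"
      by transfer (simp add: mult.commute flip: Bochner_Integration.integral_cnj)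
    then show ?thesis by (simp add: inner_L2_def)
  qed
  show "inner (f + g) h = inner f h + inner g h"
  proof -
    have "cinner (f + g) h = cinner f h + cinner g h"
      by transfer (auto simp: distrib_right integrable_mult_cnj)
    then show ?thesis by (simp add: inner_L2_def)
  qed
  show "inner (r *\<^sub>R f) g = r * inner f g"
  proof -
    have "cinner (of_real r *\<^sub>C f) g = of_real r * cinner f g"
      by transfer (auto simp: mult.assoc)
    then show ?thesis by (simp add: inner_L2_def scaleR_L2_def)
  qed
  show "norm f = sqrt (inner f f)" by (simp add: norm_L2_def)
  have ff: "(\<integral>t. u t * cnj (u t) \<partial>lborel) = of_real (\<integral>t. (cmod (u t))\<^sup>2 \<partial>lborel)"
    for u :: "'a \<Rightarrow> complex"
    by (simp only: complex_norm_square[symmetric] integral_complex_of_real)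
  show "0 \<le> inner f f"
    unfolding inner_L2_def by transfer (simp add: ff)
  show "inner f f = 0 \<longleftrightarrow> f = 0"
    unfolding inner_L2_def
    by transfer (auto simp: ff square_integrable_zero square_integrable_def
        integral_nonneg_eq_0_iff_AE)
qed

end

section \<open>Time-frequency shifts and unitary operators\<close>

lift_definition translation :: "'a::euclidean_space \<Rightarrow> 'a L2 \<Rightarrow> 'a L2"
  is "\<lambda>x f t. f (t - x)"
  by (intro conjI square_integrable_shift
      AE_lborel_shift[where P = "\<lambda>t. f t = g t" for f g :: "'a \<Rightarrow> complex"]) auto

lift_definition modulation :: "'a::euclidean_space \<Rightarrow> 'a L2 \<Rightarrow> 'a L2"
  is "\<lambda>w f t. exp (2 * of_real pi * \<i> * of_real (t \<bullet> w)) * f t"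
  by (auto intro: square_integrable_modulate elim: eventually_mono)

text \<open>A point $z = (x, \omega)$ of $\mathbb R^{2d}$ is a vector indexed by \<open>'d + 'd\<close>, with the
  indices \<open>Inl i\<close> for $x$ and \<open>Inr i\<close> for $\omega$.\<close>

definition time_part :: "real ^ ('d::finite + 'd) \<Rightarrow> real ^ 'd" where
  "time_part z = (\<chi> i. z $ Inl i)"

definition freq_part :: "real ^ ('d::finite + 'd) \<Rightarrow> real ^ 'd" where
  "freq_part z = (\<chi> i. z $ Inr i)"

definition tf_shift :: "real ^ ('d::finite + 'd) \<Rightarrow> (real ^ 'd) L2 \<Rightarrow> (real ^ 'd) L2" where
  "tf_shift z f = modulation (freq_part z) (translation (time_part z) f)"

definition sym_tf_shift :: "real ^ ('d::finite + 'd) \<Rightarrow> (real ^ 'd) L2 \<Rightarrow> (real ^ 'd) L2" where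
  "sym_tf_shift z f =
     exp (- (of_real pi * \<i> * of_real (time_part z \<bullet> freq_part z))) *\<^sub>C tf_shift z f"

definition unitary :: "('a::euclidean_space L2 \<Rightarrow> 'a L2) \<Rightarrow> bool" where
  "unitary U \<longleftrightarrow>
     (\<forall>f g. U (f + g) = U f + U g) \<and> (\<forall>c f. U (c *\<^sub>C f) = c *\<^sub>C U f) \<and>
     (\<forall>f g. cinner (U f) (U g) = cinner f g) \<and> surj U"

definition cadjoint :: "('a::euclidean_space L2 \<Rightarrow> 'a L2) \<Rightarrow> 'a L2 \<Rightarrow> 'a L2" where
  "cadjoint T = (SOME T'. \<forall>f g. cinner (T f) g = cinner f (T' g))"

section \<open>Symplectic matrices\<close>

definition J_mat :: "real ^ ('d::finite + 'd) ^ ('d + 'd)" where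
  "J_mat = (\<chi> i j. case (i, j) of
       (Inl a, Inr b) \<Rightarrow> if a = b then 1 else 0
     | (Inr a, Inl b) \<Rightarrow> if a = b then - 1 else 0
     | _ \<Rightarrow> 0)"

definition Sp :: "(real ^ ('d::finite + 'd) ^ ('d + 'd)) set" where
  "Sp = {S. transpose S ** J_mat ** S = J_mat}"

definition rho_related ::
    "((real ^ 'd) L2 \<Rightarrow> (real ^ 'd) L2) \<Rightarrow> real ^ ('d::finite + 'd) ^ ('d + 'd) \<Rightarrow> bool" where
  "rho_related U S \<longleftrightarrow> (\<forall>z. U \<circ> sym_tf_shift z \<circ> cadjoint U = sym_tf_shift (S *v z))"

section \<open>Gabor systems\<close>

definition is_lattice :: "(real ^ ('d::finite + 'd)) set \<Rightarrow> bool" where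
  "is_lattice L \<longleftrightarrow>
     (\<exists>A :: real ^ ('d + 'd) ^ ('d + 'd). invertible A \<and> L = (*v) A ` {k. \<forall>i. k $ i \<in> \<int>})"

definition adjoint_lattice :: "(real ^ ('d::finite + 'd)) set \<Rightarrow> (real ^ ('d + 'd)) set" where
  "adjoint_lattice L = {z. \<forall>l\<in>L. tf_shift z \<circ> tf_shift l = tf_shift l \<circ> tf_shift z}"

text \<open>The sums of squares are taken in \<open>ennreal\<close>, where a divergent sum is \<open>\<infinity>\<close>; the upper bound
  below therefore includes convergence.\<close>

definition gabor_sum :: "(real ^ 'd) L2 \<Rightarrow> (real ^ ('d::finite + 'd)) set \<Rightarrow> (real ^ 'd) L2 \<Rightarrow> ennreal"
  where "gabor_sum g L f = (\<Sum>\<^sub>\<infinity>z\<in>L. ennreal ((cmod (cinner f (tf_shift z g)))\<^sup>2))"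

definition upper_bounds :: "(real ^ 'd) L2 \<Rightarrow> (real ^ ('d::finite + 'd)) set \<Rightarrow> real set" where
  "upper_bounds g L = {C. C > 0 \<and> (\<forall>f. gabor_sum g L f \<le> ennreal (C * (norm f)\<^sup>2))}"

definition lower_bounds :: "(real ^ 'd) L2 \<Rightarrow> (real ^ ('d::finite + 'd)) set \<Rightarrow> real set" where
  "lower_bounds g L = {C. C > 0 \<and> (\<forall>f. ennreal (C * (norm f)\<^sup>2) \<le> gabor_sum g L f)}"

definition is_bessel :: "(real ^ 'd) L2 \<Rightarrow> (real ^ ('d::finite + 'd)) set \<Rightarrow> bool" where
  "is_bessel g L \<longleftrightarrow> upper_bounds g L \<noteq> {}"

definition is_gabor_frame :: "(real ^ 'd) L2 \<Rightarrow> (real ^ ('d::finite + 'd)) set \<Rightarrow> bool" where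
  "is_gabor_frame g L \<longleftrightarrow> is_bessel g L \<and> lower_bounds g L \<noteq> {}"

text \<open>The infimum is a minimum except for \<open>g = 0\<close>, where every \<open>C > 0\<close> is a Bessel bound.\<close>

definition optimal_upper_bound :: "(real ^ 'd) L2 \<Rightarrow> (real ^ ('d::finite + 'd)) set \<Rightarrow> real" where
  "optimal_upper_bound g L = Inf (upper_bounds g L)"

definition optimal_lower_bound :: "(real ^ 'd) L2 \<Rightarrow> (real ^ ('d::finite + 'd)) set \<Rightarrow> real" where
  "optimal_lower_bound g L = Sup (lower_bounds g L)"

text \<open>The sum is the unconditional sum in the norm of \<open>(real ^ 'd) L2\<close>.\<close>

definition frame_operator ::
    "(real ^ ('d::finite + 'd)) set \<Rightarrow> (real ^ 'd) L2 \<Rightarrow> (real ^ 'd) L2 \<Rightarrow> (real ^ 'd) L2 \<Rightarrow> (real ^ 'd) L2"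
  where "frame_operator L g h f = (\<Sum>\<^sub>\<infinity>z\<in>L. cinner f (tf_shift z g) *\<^sub>C tf_shift z h)"

end

theory Submission
  imports Defs
begin

text \<open>Since $U\rho(z) = \rho(Sz)U$, we have $U\pi(z) = c(z)\,\pi(Sz)U$ with a unimodular factor $c(z)$.
  The factor drops out of the squares $|\langle f, \pi(z)g\rangle|^2$, of the terms
  $\langle f, \pi(z)g\rangle\,\pi(z)h$ and of the commutation relation of two time-frequency shifts.
  Everything then follows by reindexing along the bijection $S$ and substituting along the
  bijection $U$.\<close>

section \<open>Complex scalars in \<open>L2\<close>\<close>

lemma scaleC_scaleC: "a *\<^sub>C b *\<^sub>C f = (a * b) *\<^sub>C f"
  by transfer (auto intro!: square_integrable_scale simp: mult.assoc)

lemma scaleC_one [simp]: "1 *\<^sub>C f = f"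
  by transfer auto

lemma scaleC_left_cancel: "c \<noteq> 0 \<Longrightarrow> c *\<^sub>C f = c *\<^sub>C g \<longleftrightarrow> f = g"
  by (metis left_inverse scaleC_one scaleC_scaleC)

lemma cinner_scaleC_right: "cinner f (c *\<^sub>C g) = cnj c * cinner f g"
  by transfer (simp add: mult_ac flip: integral_mult_right_zero)

text \<open>The real part of \<open>cinner\<close> is the real inner product, which is
  nondegenerate. This yields both injectivity of unitaries and uniqueness of adjoints.\<close>

lemma cinner_right_ext:
  assumes "\<And>f. cinner f g = cinner f h"
  shows "g = h"
proof -
  have "\<forall>f. inner f g = inner f h"
    by (simp add: inner_L2_def assms)
  then show ?thesis by (simp only: vector_eq_ldot)
qed

lemma modulation_scaleC: "modulation w (c *\<^sub>C f) = c *\<^sub>C modulation w f"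
  by transfer (auto intro!: square_integrable_scale square_integrable_modulate simp: mult.left_commute)

lemma translation_scaleC: "translation x (c *\<^sub>C f) = c *\<^sub>C translation x f"
  by transfer (auto intro!: square_integrable_scale square_integrable_shift)

lemma tf_shift_scaleC: "tf_shift z (c *\<^sub>C f) = c *\<^sub>C tf_shift z f"
  by (simp add: tf_shift_def modulation_scaleC translation_scaleC)

lemma tf_shift_eq_sym_tf_shift:
  "tf_shift z f = exp (of_real pi * \<i> * of_real (time_part z \<bullet> freq_part z)) *\<^sub>C sym_tf_shift z f"
  by (simp add: sym_tf_shift_def scaleC_scaleC flip: exp_add)

section \<open>Unitary operators\<close>

lemma unitary_scaleC: "unitary U \<Longrightarrow> U (c *\<^sub>C f) = c *\<^sub>C U f"
  by (simp add: unitary_def)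

lemma unitary_cinner: "unitary U \<Longrightarrow> cinner (U f) (U g) = cinner f g"
  by (simp add: unitary_def)

lemma unitary_norm: "unitary U \<Longrightarrow> norm (U f) = norm f"
  by (simp add: norm_L2_def inner_L2_def unitary_cinner)

lemma unitary_bounded_linear:
  assumes "unitary U"
  shows "bounded_linear U"
proof
  show "U (f + g) = U f + U g" for f g
    using assms by (simp add: unitary_def)
  show "U (r *\<^sub>R f) = r *\<^sub>R U f" for r f
    using assms by (simp add: scaleR_L2_def unitary_scaleC)
  show "\<exists>K. \<forall>f. norm (U f) \<le> norm f * K"
    using assms by (auto simp: unitary_norm intro!: exI[of _ 1])
qed

lemma unitary_bij:
  assumes "unitary U"
  shows "bij U"
proof (rule bijI)
  show "inj U"
  proof (rule injI)
    fix f g assume "U f = U g"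
    then have "cinner k f = cinner k g" for k
      by (metis assms unitary_cinner)
    then show "f = g" by (rule cinner_right_ext)
  qed
qed (use assms in \<open>simp add: unitary_def\<close>)

text \<open>Used in \<open>unitary_infsum\<close>, where summability has to pass back through a
  bounded linear inverse.\<close>

lemma unitary_inv:
  assumes "unitary U"
  shows "unitary (inv U)"
proof -
  have b: "bij U" using assms by (rule unitary_bij)
  have U: "U (inv U f) = f" and V: "inv U (U f) = f" for f
    using b by (simp_all add: bij_is_surj surj_f_inv_f bij_is_inj)
  show ?thesis
    using assms b unfolding unitary_def
    by (metis U V bij_imp_bij_inv bij_is_surj)
qed

text \<open>\<open>cadjoint\<close> is a choice among adjoints. Since \<open>inv U\<close> is an
  adjoint, the choice is made from a nonempty set, and nondegeneracy of \<open>cinner\<close> leaves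
  only one candidate.\<close>

lemma cadjoint_unitary:
  assumes "unitary U"
  shows "cadjoint U = inv U"
proof -
  have "cinner (U f) g = cinner f (inv U g)" for f g
    using assms unitary_bij[OF assms] by (metis bij_inv_eq_iff unitary_cinner)
  then have "\<exists>T. \<forall>f g. cinner (U f) g = cinner f (T g)"
    by blast
  then have "\<forall>f g. cinner (U f) g = cinner f (cadjoint U g)"
    unfolding cadjoint_def by (rule someI_ex)
  then have "cadjoint U g = inv U g" for g
    using \<open>\<And>f g. cinner (U f) g = cinner f (inv U g)\<close> by (intro cinner_right_ext) metis
  then show ?thesis by blast
qed

text \<open>As \<open>U\<close> is a homeomorphism, both sums converge or neither does, and a divergent
  \<^const>\<open>infsum\<close> is \<open>0\<close>.\<close>

lemma unitary_infsum:
  assumes "unitary U"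
  shows "(\<Sum>\<^sub>\<infinity>x\<in>A. U (F x)) = U (\<Sum>\<^sub>\<infinity>x\<in>A. F x)"
proof (rule infsum_bounded_linear_strong)
  show "(\<lambda>x. U (F x)) summable_on A \<longleftrightarrow> F summable_on A"
    using unitary_bij[OF assms]
    by (intro summable_on_bounded_linear_iff[where h' = "inv U"] unitary_bounded_linear
        unitary_inv assms) (simp add: bij_is_inj)
qed (rule unitary_bounded_linear[OF assms])

section \<open>Symplectic matrices\<close>

lemma J_mat_mult_Inl: "(J_mat *v v) $ Inl i = v $ Inr i"
  by (simp add: J_mat_def matrix_vector_mult_def UNIV_Plus_UNIV[symmetric] sum.Plus
      if_distribR if_distrib[of "\<lambda>x. x * y" for y] cong: if_cong del: UNIV_Plus_UNIV)

lemma J_mat_mult_Inr: "(J_mat *v v) $ Inr i = - v $ Inl i"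
  by (simp add: J_mat_def matrix_vector_mult_def UNIV_Plus_UNIV[symmetric] sum.Plus
      if_distribR if_distrib[of "\<lambda>x. x * y" for y] cong: if_cong del: UNIV_Plus_UNIV)

lemma inj_J_mat: "inj ((*v) J_mat)"
proof (rule injI)
  fix v w :: "real ^ ('d::finite + 'd)"
  assume eq: "J_mat *v v = J_mat *v w"
  have "v $ k = w $ k" for k
    \<comment> \<open>For \<open>k = Inl i\<close> the second equation compares the entries at
      \<open>k\<close>, for \<open>k = Inr i\<close> the first. The other one contains a projection
      from the wrong summand, but remains a true equation.\<close>
    using arg_cong[OF eq, of "\<lambda>u. u $ Inl (projr k)"] arg_cong[OF eq, of "\<lambda>u. u $ Inr (projl k)"]
    by (cases k) (simp_all add: J_mat_mult_Inl J_mat_mult_Inr)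
  then show "v = w" by (simp add: vec_eq_iff)
qed

text \<open>Applying \<open>transpose S ** J_mat\<close> to \<open>S *v v\<close> gives
  \<open>J_mat *v v\<close>, so \<open>S\<close> inherits injectivity from
  \<open>J_mat\<close>.\<close>

lemma inj_Sp:
  assumes "S \<in> Sp"
  shows "inj ((*v) S)"
proof (rule injI)
  fix v w assume "S *v v = S *v w"
  then have "(transpose S ** J_mat ** S) *v v = (transpose S ** J_mat ** S) *v w"
    by (simp flip: matrix_vector_mul_assoc)
  then show "v = w"
    using assms inj_J_mat by (auto simp: Sp_def dest: injD)
qed

lemma surj_Sp:
  assumes "S \<in> Sp"
  shows "surj ((*v) S)"
  using inj_Sp[OF assms] by (simp add: linear_injective_imp_surjective)

section \<open>Intertwining of time-frequency shifts and its consequences\<close>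

lemma rho_related_tf_shift:
  fixes S :: "real ^ ('d::finite + 'd) ^ ('d + 'd)"
  assumes "unitary U" "rho_related U S"
  obtains c where "cmod c = 1" "\<And>f. U (tf_shift z f) = c *\<^sub>C tf_shift (S *v z) (U f)"
proof -
  \<comment> \<open>The relation is evaluated at \<open>U f\<close>, so that the adjoint
    cancels.\<close>
  have "U (sym_tf_shift z (inv U (U f))) = sym_tf_shift (S *v z) (U f)" for f
    using assms by (metis rho_related_def cadjoint_unitary comp_apply)
  then have sym: "U (sym_tf_shift z f) = sym_tf_shift (S *v z) (U f)" for f
    using unitary_bij[OF assms(1)] by (simp add: bij_is_inj)
  let ?e = "\<lambda>z::real ^ ('d + 'd). of_real pi * \<i> * complex_of_real (time_part z \<bullet> freq_part z)"
  show thesis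
  proof (rule that)
    \<comment> \<open>One phase comes from passing from pi to rho at \<open>z\<close>, the other
      from passing back at \<open>S *v z\<close>.\<close>
    show "cmod (exp (?e z) * exp (- ?e (S *v z))) = 1"
      by (simp add: norm_mult)
    show "U (tf_shift z f) = (exp (?e z) * exp (- ?e (S *v z))) *\<^sub>C tf_shift (S *v z) (U f)" for f
      unfolding tf_shift_eq_sym_tf_shift[of z]
      by (simp add: unitary_scaleC[OF assms(1)] sym)
        (simp add: sym_tf_shift_def scaleC_scaleC)
  qed
qed

text \<open>The terms agree one by one. The sums lie in \<open>ennreal\<close>, so the equality also
  covers divergence and serves upper and lower bounds alike.\<close>

lemma gabor_sum_unitary:
  assumes "inj ((*v) S)" "unitary U" "rho_related U S"
  shows "gabor_sum (U g) ((*v) S ` L) (U f) = gabor_sum g L f"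
proof -
  have "cmod (cinner (U f) (tf_shift (S *v z) (U g))) = cmod (cinner f (tf_shift z g))" for z
  proof -
    obtain c where c: "cmod c = 1" "\<And>f. U (tf_shift z f) = c *\<^sub>C tf_shift (S *v z) (U f)"
      using rho_related_tf_shift assms by metis
    have "cinner f (tf_shift z g) = cnj c * cinner (U f) (tf_shift (S *v z) (U g))"
      by (metis assms(2) c(2) cinner_scaleC_right unitary_cinner)
    then show ?thesis by (simp add: norm_mult c(1))
  qed
  then show ?thesis
    unfolding gabor_sum_def using inj_on_subset[OF assms(1)]
    by (subst infsum_reindex) (auto simp: o_def)
qed

text \<open>Equality of the whole sets of bounds settles (i), (ii) and the optimal bounds together,
  as all of these are defined from the two sets.\<close>

lemma
  assumes "inj ((*v) S)" "unitary U" "rho_related U S"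
  shows upper_bounds_unitary: "upper_bounds (U g) ((*v) S ` L) = upper_bounds g L"
    and lower_bounds_unitary: "lower_bounds (U g) ((*v) S ` L) = lower_bounds g L"
proof -
  have surj: "(\<forall>f. P f) \<longleftrightarrow> (\<forall>f. P (U f))" for P
    using unitary_bij[OF assms(2)] by (metis bij_pointE)
  show "upper_bounds (U g) ((*v) S ` L) = upper_bounds g L"
    unfolding upper_bounds_def
    by (subst surj) (simp add: gabor_sum_unitary[OF assms] unitary_norm[OF assms(2)])
  show "lower_bounds (U g) ((*v) S ` L) = lower_bounds g L"
    unfolding lower_bounds_def
    by (subst surj) (simp add: gabor_sum_unitary[OF assms] unitary_norm[OF assms(2)])
qed

lemma frame_operator_unitary:
  assumes "inj ((*v) S)" "unitary U" "rho_related U S"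
  shows "frame_operator ((*v) S ` L) (U g) (U h) (U f) = U (frame_operator L g h f)"
proof -
  have "cinner (U f) (tf_shift (S *v z) (U g)) *\<^sub>C tf_shift (S *v z) (U h)
      = U (cinner f (tf_shift z g) *\<^sub>C tf_shift z h)" for z
  proof -
    obtain c where c: "cmod c = 1" "\<And>f. U (tf_shift z f) = c *\<^sub>C tf_shift (S *v z) (U f)"
      using rho_related_tf_shift assms by metis
    \<comment> \<open>The conjugate factor comes from the second slot of \<open>cinner\<close>, the
      plain one from moving \<open>U\<close> past the shift of \<open>h\<close>; they
      cancel.\<close>
    have "cnj c * c = 1"
      using c(1) by (simp add: mult.commute flip: complex_norm_square)
    moreover have "cinner f (tf_shift z g) = cnj c * cinner (U f) (tf_shift (S *v z) (U g))"
      by (metis assms(2) c(2) cinner_scaleC_right unitary_cinner)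
    ultimately have "cinner f (tf_shift z g) * c = cinner (U f) (tf_shift (S *v z) (U g))"
      by (simp add: mult.commute mult.left_commute)
    then show ?thesis
      by (simp add: unitary_scaleC[OF assms(2)] c(2) scaleC_scaleC)
  qed
  then show ?thesis
    unfolding frame_operator_def using inj_on_subset[OF assms(1)]
    by (subst infsum_reindex) (auto simp: o_def unitary_infsum[OF assms(2)])
qed

lemma tf_shift_commute_unitary:
  assumes "unitary U" "rho_related U S"
  shows "tf_shift (S *v z) \<circ> tf_shift (S *v l) = tf_shift (S *v l) \<circ> tf_shift (S *v z)
    \<longleftrightarrow> tf_shift z \<circ> tf_shift l = tf_shift l \<circ> tf_shift z"
proof -
  obtain c where c: "cmod c = 1" "\<And>f. U (tf_shift z f) = c *\<^sub>C tf_shift (S *v z) (U f)"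
    using rho_related_tf_shift assms by metis
  obtain d where d: "cmod d = 1" "\<And>f. U (tf_shift l f) = d *\<^sub>C tf_shift (S *v l) (U f)"
    using rho_related_tf_shift assms by metis
  \<comment> \<open>Both orders of composition pick up the same factor \<open>c * d\<close>, which
    can be cancelled.\<close>
  have nz: "c * d \<noteq> 0" using c(1) d(1) by auto
  have zl: "U (tf_shift z (tf_shift l f)) = (c * d) *\<^sub>C tf_shift (S *v z) (tf_shift (S *v l) (U f))" for f
    by (simp add: c(2) d(2) tf_shift_scaleC scaleC_scaleC)
  have lz: "U (tf_shift l (tf_shift z f)) = (c * d) *\<^sub>C tf_shift (S *v l) (tf_shift (S *v z) (U f))" for f
    by (simp add: c(2) d(2) tf_shift_scaleC scaleC_scaleC mult.commute)
  have "tf_shift z \<circ> tf_shift l = tf_shift l \<circ> tf_shift z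
      \<longleftrightarrow> (\<forall>f. U (tf_shift z (tf_shift l f)) = U (tf_shift l (tf_shift z f)))"
    using unitary_bij[OF assms(1)] by (simp add: fun_eq_iff bij_is_inj inj_eq)
  also have "\<dots> \<longleftrightarrow> (\<forall>f. tf_shift (S *v z) (tf_shift (S *v l) (U f))
      = tf_shift (S *v l) (tf_shift (S *v z) (U f)))"
    by (simp add: zl lz scaleC_left_cancel[OF nz])
  also have "\<dots> \<longleftrightarrow> tf_shift (S *v z) \<circ> tf_shift (S *v l) = tf_shift (S *v l) \<circ> tf_shift (S *v z)"
    using unitary_bij[OF assms(1)] unfolding fun_eq_iff comp_apply by (metis bij_pointE)
  finally show ?thesis by blast
qed

lemma adjoint_lattice_unitary:
  assumes "surj ((*v) S)" "unitary U" "rho_related U S"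
  shows "adjoint_lattice ((*v) S ` L) = (*v) S ` adjoint_lattice L"
proof -
  have "S *v z \<in> adjoint_lattice ((*v) S ` L) \<longleftrightarrow> z \<in> adjoint_lattice L" for z
    using tf_shift_commute_unitary[OF assms(2,3)] by (auto simp: adjoint_lattice_def)
  \<comment> \<open>The equivalence only speaks of points \<open>S *v z\<close>, hence of a
    preimage; surjectivity of \<open>S\<close> turns it into the claimed image.\<close>
  then have "(*v) S -` adjoint_lattice ((*v) S ` L) = adjoint_lattice L"
    by auto
  then show ?thesis
    using assms(1) by (metis surj_image_vimage_eq)
qed

theorem corollary3p2:
  fixes S :: "real ^ ('d::finite + 'd) ^ ('d + 'd)"
    and U :: "(real ^ 'd) L2 \<Rightarrow> (real ^ 'd) L2"
    and \<Lambda> :: "(real ^ ('d + 'd)) set"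
    and g h :: "(real ^ 'd) L2"
  assumes "S \<in> Sp" and "unitary U" and "rho_related U S" and "is_lattice \<Lambda>"
  shows "(is_bessel g \<Lambda> \<longleftrightarrow> is_bessel (U g) ((*v) S ` \<Lambda>)) \<and>
    (is_gabor_frame g \<Lambda> \<longleftrightarrow> is_gabor_frame (U g) ((*v) S ` \<Lambda>)) \<and>
    (is_bessel g \<Lambda> \<and> is_bessel h \<Lambda> \<longrightarrow>
       frame_operator ((*v) S ` \<Lambda>) (U g) (U h) = U \<circ> frame_operator \<Lambda> g h \<circ> cadjoint U) \<and>
    (is_bessel g \<Lambda> \<longrightarrow>
       optimal_upper_bound g \<Lambda> = optimal_upper_bound (U g) ((*v) S ` \<Lambda>)) \<and>
    (is_gabor_frame g \<Lambda> \<longrightarrow>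
       optimal_lower_bound g \<Lambda> = optimal_lower_bound (U g) ((*v) S ` \<Lambda>) \<and>
       optimal_upper_bound g \<Lambda> = optimal_upper_bound (U g) ((*v) S ` \<Lambda>)) \<and>
    adjoint_lattice ((*v) S ` \<Lambda>) = (*v) S ` adjoint_lattice \<Lambda>"
proof -
  note inj = inj_Sp[OF assms(1)]
  note bounds = upper_bounds_unitary[OF inj assms(2,3)] lower_bounds_unitary[OF inj assms(2,3)]
  \<comment> \<open>Every \<open>f\<close> is \<open>U\<close> applied to \<open>inv U f\<close>,
    and \<open>inv U\<close> is the adjoint.\<close>
  have "frame_operator ((*v) S ` \<Lambda>) (U g) (U h) f = U (frame_operator \<Lambda> g h (cadjoint U f))" for f
    using frame_operator_unitary[OF inj assms(2,3), of \<Lambda> g h "inv U f"] unitary_bij[OF assms(2)]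
    by (simp add: cadjoint_unitary[OF assms(2)] bij_is_surj surj_f_inv_f)
  then show ?thesis
    using adjoint_lattice_unitary[OF surj_Sp[OF assms(1)] assms(2,3)]
    by (simp add: is_bessel_def is_gabor_frame_def optimal_upper_bound_def
        optimal_lower_bound_def bounds fun_eq_iff)
qed

end
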